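(* Let $(M^{2n+s},\phi,\xi_i,\eta_j,g)$ be a metric $f$-manifold whose characteristic vector fields commute, i.e. $[\xi_i,\xi_j]=0$ for all $i,j\in\{1,\dots,s\}$. Suppose that $\nabla=\nabla^g+\frac12T$ is a metric connection with skew-torsion $T$ satisfying $\nabla g=0$, $\nabla\phi=0$, $\nabla\xi_i=0$ and $\nabla\eta_i=0$ for all $i=1,\dots,s$. Then the torsion 3-form $T$ is given by $$T=\sum_{i=1}^{s}\eta_i\wedge d\eta_i+d^{\phi}F+N^{(1)}-\sum_{i=1}^{s}\eta_i\wedge(\xi_i\lrcorner N^{(1)}).$$
   Context: Manifolds are smooth and connected. A metric $f$-manifold $(M^{2n+s},\phi,\xi_i,\eta_j,g)$ is a $(2n+s)$-dimensional manifold $M$ with a $(1,1)$-tensor field $\phi$ of constant rank $2n$ satisfying $\phi^3+\phi=0$, global vector fields $\xi_1,\dots,\xi_s$ (the characteristic vector fields) and 1-forms $\eta_1,\dots,\eta_s$ with $\ker\phi=\langle\xi_1,\dots,\xi_s\rangle$, $\eta_i(\xi_j)=\delta_{ij}$, $\eta_i\circ\phi=0$, $\phi^2=-\mathrm{Id}+\sum_i\eta_i\otimes\xi_i$, and a Riemannian metric $g$ with $g(\phi X,\phi Y)=g(X,Y)-\sum_i\eta_i(X)\eta_i(Y)$. (For $s=0$ terms involving $\xi_i,\eta_i$ are omitted.) $\nabla^g$ is the Levi-Civita connection of $g$. The fundamental 2-form is $F(X,Y)=g(X,\phi Y)$, and $d^{\phi}F(X,Y,Z):=-dF(\phi X,\phi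 Y,\phi Z)$. Convention: $d\eta(X,Y)=X\eta(Y)-Y\eta(X)-\eta([X,Y])$, and correspondingly (no numerical factors) for 2-forms; $u\wedge v=u\otimes v-v\otimes u$ for 1-forms, and for a 1-form $\eta$ and a 2-form $\omega$, $(\eta\wedge\omega)(X,Y,Z)=\eta(X)\omega(Y,Z)-\eta(Y)\omega(X,Z)+\eta(Z)\omega(X,Y)$. The Nijenhuis tensor is $N^{(1)}=N_\phi+\sum_i d\eta_i\otimes\xi_i$ with $N_\phi(X,Y)=[\phi X,\phi Y]+\phi^2[X,Y]-\phi[X,\phi Y]-\phi[\phi X,Y]$; write $N^{(1)}(X,Y,Z)=g(N^{(1)}(X,Y),Z)$. (Existence of such a $\nabla$ forces $N^{(1)}$ to be a 3-form, so the formula makes sense.) A connection has skew-torsion if $T(X,Y,Z):=g(T(X,Y),Z)$ is a 3-form, where $T(X,Y)=\nabla_XY-\nabla_YX-[X,Y]$. The notation $\nabla=\nabla^g+\frac12T$ means $g(\nabla_XY,Z)=g(\nabla^g_XY,Z)+\frac12T(X,Y,Z)$. *)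

theory Defs
  imports "HOL-Analysis.Analysis" "HOL-Library.Function_Algebras"
begin

text \<open>The pointwise real vector space structure on functions. It makes tangent vectors (functionals
  on functions) and vector fields elements of a real vector space, so that \<^const>\<open>span\<close> and
  \<^const>\<open>dim\<close> apply to subspaces of tangent spaces.\<close>

instantiation "fun" :: (type, real_vector) real_vector
begin

definition scaleR_fun :: "real \<Rightarrow> ('a \<Rightarrow> 'b) \<Rightarrow> 'a \<Rightarrow> 'b"
  where "scaleR_fun c f = (\<lambda>x. c *\<^sub>R f x)"

instance
  by standard (auto simp: scaleR_fun_def fun_eq_iff algebra_simps)

end


section \<open>Smooth manifolds\<close>

text \<open>On a finite-dimensional space the conditions below on all directional derivatives say that
  \<open>f\<close> is of class \<open>C\<^sup>k\<close> on the open set \<open>S\<close>.\<close>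

primrec Ck_on :: "nat \<Rightarrow> 'e::real_normed_vector set \<Rightarrow> ('e \<Rightarrow> 'b::real_normed_vector) \<Rightarrow> bool" where
  "Ck_on 0 S f \<longleftrightarrow> continuous_on S f"
| "Ck_on (Suc k) S f \<longleftrightarrow>
     (\<forall>x\<in>S. f differentiable (at x)) \<and> (\<forall>v. Ck_on k S (\<lambda>x. frechet_derivative f (at x) v))"

definition smooth_on :: "'e::real_normed_vector set \<Rightarrow> ('e \<Rightarrow> 'b::real_normed_vector) \<Rightarrow> bool"
  where "smooth_on S f \<longleftrightarrow> (\<forall>k. Ck_on k S f)"

text \<open>A chart is a domain together with a coordinate map; only the values of the map on the domain
  matter.\<close>

type_synonym ('a, 'e) chart = "'a set \<times> ('a \<Rightarrow> 'e)"

text \<open>The manifold is the whole type \<open>'a\<close>, its smooth structure is the one generated by the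
  atlas \<open>A\<close>. The model space \<open>'e\<close> is a normed space possessing a basis of \<open>m\<close>
  vectors, i.e. a copy of \<open>\<real>\<^sup>m\<close>; the class \<^class>\<open>euclidean_space\<close> would exclude
  \<open>m = 0\<close>.\<close>

locale smooth_manifold =
  fixes A :: "('a::{t2_space, second_countable_topology}, 'e::real_normed_vector) chart set"
    and m :: nat
  assumes connected_manifold: "connected (UNIV :: 'a set)"
    and model_dim: "\<exists>B :: 'e set. finite B \<and> card B = m \<and> independent B \<and> span B = UNIV"
    and charts_homeomorphism:
      "\<And>U \<psi>. (U, \<psi>) \<in> A \<Longrightarrow>
         open U \<and> open (\<psi> ` U) \<and> homeomorphism U (\<psi> ` U) \<psi> (inv_into U \<psi>)"
    and charts_cover: "(\<Union>(U, \<psi>)\<in>A. U) = UNIV"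
    and charts_compatible:
      "\<And>U \<psi> V \<kappa>. (U, \<psi>) \<in> A \<Longrightarrow> (V, \<kappa>) \<in> A \<Longrightarrow>
         smooth_on (\<psi> ` (U \<inter> V)) (\<kappa> \<circ> inv_into U \<psi>)"

definition smooth_funs :: "('a, 'e::real_normed_vector) chart set \<Rightarrow> ('a \<Rightarrow> real) set"
  where "smooth_funs A = {f. \<forall>(U, \<psi>)\<in>A. smooth_on (\<psi> ` U) (f \<circ> inv_into U \<psi>)}"


section \<open>Tangent vectors and vector fields\<close>

type_synonym 'a tvec = "('a \<Rightarrow> real) \<Rightarrow> real"
type_synonym 'a vfield = "'a \<Rightarrow> 'a tvec"

text \<open>Tangent vectors at \<open>p\<close> are the derivations at \<open>p\<close> of the algebra of smooth functions.
  The value \<open>0\<close> on non-smooth functions is a normalisation: it makes a tangent vector determined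
  by its values on smooth functions.\<close>

definition tangent_space :: "('a, 'e::real_normed_vector) chart set \<Rightarrow> 'a \<Rightarrow> 'a tvec set"
  where "tangent_space A p = {v.
    (\<forall>f\<in>smooth_funs A. \<forall>h\<in>smooth_funs A. \<forall>a b. v (\<lambda>x. a * f x + b * h x) = a * v f + b * v h) \<and>
    (\<forall>f\<in>smooth_funs A. \<forall>h\<in>smooth_funs A. v (\<lambda>x. f x * h x) = f p * v h + h p * v f) \<and>
    (\<forall>f. f \<notin> smooth_funs A \<longrightarrow> v f = 0)}"

definition vfields :: "('a, 'e::real_normed_vector) chart set \<Rightarrow> 'a vfield set"
  where "vfields A = {X. (\<forall>p. X p \<in> tangent_space A p) \<and>
    (\<forall>f\<in>smooth_funs A. (\<lambda>p. X p f) \<in> smooth_funs A)}"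

definition vderiv :: "'a vfield \<Rightarrow> ('a \<Rightarrow> real) \<Rightarrow> 'a \<Rightarrow> real"
  where "vderiv X f = (\<lambda>p. X p f)"

definition fscale :: "('a \<Rightarrow> real) \<Rightarrow> 'a vfield \<Rightarrow> 'a vfield"
  where "fscale f X = (\<lambda>p. f p *\<^sub>R X p)"

definition lie_bracket :: "'a vfield \<Rightarrow> 'a vfield \<Rightarrow> 'a vfield"
  where "lie_bracket X Y = (\<lambda>p f. vderiv X (vderiv Y f) p - vderiv Y (vderiv X f) p)"


section \<open>Tensor fields and forms\<close>

text \<open>The structure tensors are families of linear maps on the tangent spaces.\<close>

type_synonym 'a oneform = "'a \<Rightarrow> 'a tvec \<Rightarrow> real"
type_synonym 'a endo = "'a \<Rightarrow> 'a tvec \<Rightarrow> 'a tvec"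
type_synonym 'a bilin = "'a \<Rightarrow> 'a tvec \<Rightarrow> 'a tvec \<Rightarrow> real"

definition ev1 :: "'a oneform \<Rightarrow> 'a vfield \<Rightarrow> 'a \<Rightarrow> real"
  where "ev1 \<eta> X = (\<lambda>p. \<eta> p (X p))"

definition ev2 :: "'a bilin \<Rightarrow> 'a vfield \<Rightarrow> 'a vfield \<Rightarrow> 'a \<Rightarrow> real"
  where "ev2 g X Y = (\<lambda>p. g p (X p) (Y p))"

definition app :: "'a endo \<Rightarrow> 'a vfield \<Rightarrow> 'a vfield"
  where "app \<phi> X = (\<lambda>p. \<phi> p (X p))"

definition one_form :: "('a, 'e::real_normed_vector) chart set \<Rightarrow> 'a oneform \<Rightarrow> bool"
  where "one_form A \<eta> \<longleftrightarrow>
    (\<forall>p. \<forall>u\<in>tangent_space A p. \<forall>v\<in>tangent_space A p. \<forall>a b.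
       \<eta> p (a *\<^sub>R u + b *\<^sub>R v) = a * \<eta> p u + b * \<eta> p v) \<and>
    (\<forall>X\<in>vfields A. ev1 \<eta> X \<in> smooth_funs A)"

definition endo_field :: "('a, 'e::real_normed_vector) chart set \<Rightarrow> 'a endo \<Rightarrow> bool"
  where "endo_field A \<phi> \<longleftrightarrow>
    (\<forall>p. \<forall>u\<in>tangent_space A p. \<phi> p u \<in> tangent_space A p) \<and>
    (\<forall>p. \<forall>u\<in>tangent_space A p. \<forall>v\<in>tangent_space A p. \<forall>a b.
       \<phi> p (a *\<^sub>R u + b *\<^sub>R v) = a *\<^sub>R \<phi> p u + b *\<^sub>R \<phi> p v) \<and>
    (\<forall>X\<in>vfields A. app \<phi> X \<in> vfields A)"

definition riemannian_metric :: "('a, 'e::real_normed_vector) chart set \<Rightarrow> 'a bilin \<Rightarrow> bool"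
  where "riemannian_metric A g \<longleftrightarrow>
    (\<forall>p. \<forall>u\<in>tangent_space A p. \<forall>v\<in>tangent_space A p. \<forall>w\<in>tangent_space A p. \<forall>a b.
       g p (a *\<^sub>R u + b *\<^sub>R v) w = a * g p u w + b * g p v w) \<and>
    (\<forall>p. \<forall>u\<in>tangent_space A p. \<forall>v\<in>tangent_space A p. g p u v = g p v u) \<and>
    (\<forall>p. \<forall>u\<in>tangent_space A p. u \<noteq> 0 \<longrightarrow> g p u u > 0) \<and>
    (\<forall>X\<in>vfields A. \<forall>Y\<in>vfields A. ev2 g X Y \<in> smooth_funs A)"

text \<open>Forms of degree 2 and 3, which arise by differentiating, are treated as maps on vector fields
  that are multilinear over the smooth functions.\<close>

type_synonym 'a form1 = "'a vfield \<Rightarrow> 'a \<Rightarrow> real"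
type_synonym 'a form2 = "'a vfield \<Rightarrow> 'a vfield \<Rightarrow> 'a \<Rightarrow> real"
type_synonym 'a form3 = "'a vfield \<Rightarrow> 'a vfield \<Rightarrow> 'a vfield \<Rightarrow> 'a \<Rightarrow> real"

text \<open>Linearity in the second and third argument follows from skew-symmetry.\<close>

definition three_form :: "('a, 'e::real_normed_vector) chart set \<Rightarrow> 'a form3 \<Rightarrow> bool"
  where "three_form A T \<longleftrightarrow>
    (\<forall>X\<in>vfields A. \<forall>Y\<in>vfields A. \<forall>Z\<in>vfields A.
       T X Y Z \<in> smooth_funs A \<and> T X Y Z = - T Y X Z \<and> T X Y Z = - T X Z Y) \<and>
    (\<forall>X\<in>vfields A. \<forall>X'\<in>vfields A. \<forall>Y\<in>vfields A. \<forall>Z\<in>vfields A.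
       \<forall>f\<in>smooth_funs A. \<forall>h\<in>smooth_funs A.
       T (fscale f X + fscale h X') Y Z = f * T X Y Z + h * T X' Y Z)"

definition ext_d1 :: "'a form1 \<Rightarrow> 'a form2"
  where "ext_d1 \<alpha> X Y = vderiv X (\<alpha> Y) - vderiv Y (\<alpha> X) - \<alpha> (lie_bracket X Y)"

definition ext_d2 :: "'a form2 \<Rightarrow> 'a form3"
  where "ext_d2 \<omega> X Y Z =
    vderiv X (\<omega> Y Z) - vderiv Y (\<omega> X Z) + vderiv Z (\<omega> X Y)
    - \<omega> (lie_bracket X Y) Z + \<omega> (lie_bracket X Z) Y - \<omega> (lie_bracket Y Z) X"

definition wedge12 :: "'a form1 \<Rightarrow> 'a form2 \<Rightarrow> 'a form3"
  where "wedge12 \<alpha> \<omega> X Y Z = \<alpha> X * \<omega> Y Z - \<alpha> Y * \<omega> X Z + \<alpha> Z * \<omega> X Y"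

definition interior3 :: "'a vfield \<Rightarrow> 'a form3 \<Rightarrow> 'a form2"
  where "interior3 V \<omega> Y Z = \<omega> V Y Z"


section \<open>Metric \<open>f\<close>-manifolds\<close>

locale metric_f_manifold =
  smooth_manifold A "2 * n + s"
  for A :: "('a::{t2_space, second_countable_topology}, 'e::real_normed_vector) chart set"
    and n s :: nat +
  fixes \<phi> :: "'a endo"
    and \<xi> :: "nat \<Rightarrow> 'a vfield"
    and \<eta> :: "nat \<Rightarrow> 'a oneform"
    and g :: "'a bilin"
  assumes phi_tensor: "endo_field A \<phi>"
    and phi_rank: "\<And>p. dim (\<phi> p ` tangent_space A p) = 2 * n"
    and phi_cubed: "\<And>p v. v \<in> tangent_space A p \<Longrightarrow> \<phi> p (\<phi> p (\<phi> p v)) + \<phi> p v = 0"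
    and xi_vfield: "\<And>i. i \<in> {1..s} \<Longrightarrow> \<xi> i \<in> vfields A"
    and eta_form: "\<And>i. i \<in> {1..s} \<Longrightarrow> one_form A (\<eta> i)"
    and phi_kernel:
      "\<And>p. {v \<in> tangent_space A p. \<phi> p v = 0} = span ((\<lambda>i. \<xi> i p) ` {1..s})"
    and eta_xi:
      "\<And>i j p. i \<in> {1..s} \<Longrightarrow> j \<in> {1..s} \<Longrightarrow> \<eta> i p (\<xi> j p) = (if i = j then 1 else 0)"
    and eta_phi:
      "\<And>i p v. i \<in> {1..s} \<Longrightarrow> v \<in> tangent_space A p \<Longrightarrow> \<eta> i p (\<phi> p v) = 0"
    and phi_squared:
      "\<And>p v. v \<in> tangent_space A p \<Longrightarrow> \<phi> p (\<phi> p v) = - v + (\<Sum>i=1..s. \<eta> i p v *\<^sub>R \<xi> i p)"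
    and metric: "riemannian_metric A g"
    and metric_compatible:
      "\<And>p u v. u \<in> tangent_space A p \<Longrightarrow> v \<in> tangent_space A p \<Longrightarrow>
         g p (\<phi> p u) (\<phi> p v) = g p u v - (\<Sum>i=1..s. \<eta> i p u * \<eta> i p v)"

definition fundamental_form :: "'a endo \<Rightarrow> 'a bilin \<Rightarrow> 'a form2"
  where "fundamental_form \<phi> g X Y = ev2 g X (app \<phi> Y)"

definition d_phi_F :: "'a endo \<Rightarrow> 'a bilin \<Rightarrow> 'a form3"
  where "d_phi_F \<phi> g X Y Z =
    - ext_d2 (fundamental_form \<phi> g) (app \<phi> X) (app \<phi> Y) (app \<phi> Z)"

definition N_phi :: "'a endo \<Rightarrow> 'a vfield \<Rightarrow> 'a vfield \<Rightarrow> 'a vfield"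
  where "N_phi \<phi> X Y =
    lie_bracket (app \<phi> X) (app \<phi> Y) + app \<phi> (app \<phi> (lie_bracket X Y))
    - app \<phi> (lie_bracket X (app \<phi> Y)) - app \<phi> (lie_bracket (app \<phi> X) Y)"

definition nijenhuis ::
  "nat \<Rightarrow> 'a endo \<Rightarrow> (nat \<Rightarrow> 'a vfield) \<Rightarrow> (nat \<Rightarrow> 'a oneform) \<Rightarrow> 'a vfield \<Rightarrow> 'a vfield \<Rightarrow> 'a vfield"
  where "nijenhuis s \<phi> \<xi> \<eta> X Y =
    N_phi \<phi> X Y + (\<Sum>i=1..s. fscale (ext_d1 (ev1 (\<eta> i)) X Y) (\<xi> i))"

definition nijenhuis_form ::
  "nat \<Rightarrow> 'a endo \<Rightarrow> (nat \<Rightarrow> 'a vfield) \<Rightarrow> (nat \<Rightarrow> 'a oneform) \<Rightarrow> 'a bilin \<Rightarrow> 'a form3"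
  where "nijenhuis_form s \<phi> \<xi> \<eta> g X Y Z = ev2 g (nijenhuis s \<phi> \<xi> \<eta> X Y) Z"


section \<open>Connections\<close>

type_synonym 'a conn = "'a vfield \<Rightarrow> 'a vfield \<Rightarrow> 'a vfield"

text \<open>\<open>D X Y\<close> is the covariant derivative of \<open>Y\<close> along \<open>X\<close>.\<close>

definition connection :: "('a, 'e::real_normed_vector) chart set \<Rightarrow> 'a conn \<Rightarrow> bool"
  where "connection A D \<longleftrightarrow>
    (\<forall>X\<in>vfields A. \<forall>Y\<in>vfields A. D X Y \<in> vfields A) \<and>
    (\<forall>X\<in>vfields A. \<forall>X'\<in>vfields A. \<forall>Y\<in>vfields A. \<forall>f\<in>smooth_funs A. \<forall>h\<in>smooth_funs A.
       D (fscale f X + fscale h X') Y = fscale f (D X Y) + fscale h (D X' Y)) \<and>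
    (\<forall>X\<in>vfields A. \<forall>Y\<in>vfields A. \<forall>Y'\<in>vfields A. D X (Y + Y') = D X Y + D X Y') \<and>
    (\<forall>X\<in>vfields A. \<forall>Y\<in>vfields A. \<forall>f\<in>smooth_funs A.
       D X (fscale f Y) = fscale (vderiv X f) Y + fscale f (D X Y))"

definition torsion :: "'a conn \<Rightarrow> 'a vfield \<Rightarrow> 'a vfield \<Rightarrow> 'a vfield"
  where "torsion D X Y = D X Y - D Y X - lie_bracket X Y"

definition cov_oneform :: "'a conn \<Rightarrow> 'a oneform \<Rightarrow> 'a vfield \<Rightarrow> 'a vfield \<Rightarrow> 'a \<Rightarrow> real"
  where "cov_oneform D \<eta> X Y = vderiv X (ev1 \<eta> Y) - ev1 \<eta> (D X Y)"

definition cov_endo :: "'a conn \<Rightarrow> 'a endo \<Rightarrow> 'a vfield \<Rightarrow> 'a vfield \<Rightarrow> 'a vfield"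
  where "cov_endo D \<phi> X Y = D X (app \<phi> Y) - app \<phi> (D X Y)"

definition cov_bilin :: "'a conn \<Rightarrow> 'a bilin \<Rightarrow> 'a vfield \<Rightarrow> 'a vfield \<Rightarrow> 'a vfield \<Rightarrow> 'a \<Rightarrow> real"
  where "cov_bilin D g X Y Z = vderiv X (ev2 g Y Z) - ev2 g (D X Y) Z - ev2 g Y (D X Z)"

definition metric_connection ::
  "('a, 'e::real_normed_vector) chart set \<Rightarrow> 'a bilin \<Rightarrow> 'a conn \<Rightarrow> bool"
  where "metric_connection A g D \<longleftrightarrow> connection A D \<and>
    (\<forall>X\<in>vfields A. \<forall>Y\<in>vfields A. \<forall>Z\<in>vfields A. cov_bilin D g X Y Z = 0)"

definition levi_civita ::
  "('a, 'e::real_normed_vector) chart set \<Rightarrow> 'a bilin \<Rightarrow> 'a conn \<Rightarrow> bool"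
  where "levi_civita A g D \<longleftrightarrow> metric_connection A g D \<and>
    (\<forall>X\<in>vfields A. \<forall>Y\<in>vfields A. torsion D X Y = 0)"

definition has_skew_torsion ::
  "('a, 'e::real_normed_vector) chart set \<Rightarrow> 'a bilin \<Rightarrow> 'a conn \<Rightarrow> 'a form3 \<Rightarrow> bool"
  where "has_skew_torsion A g D T \<longleftrightarrow> three_form A T \<and>
    (\<forall>X\<in>vfields A. \<forall>Y\<in>vfields A. \<forall>Z\<in>vfields A. T X Y Z = ev2 g (torsion D X Y) Z)"

end

theory Submission
  imports Defs
begin

text \<open>Write every Lie bracket in \<open>d\<eta>\<^sub>i\<close>, \<open>dF\<close> and \<open>N\<^sup>(\<^sup>1\<^sup>)\<close> as
  \<open>[X, Y] = \<nabla>\<^sub>X Y - \<nabla>\<^sub>Y X - T(X, Y)\<close>. Since \<open>\<eta>\<^sub>i\<close>, \<open>\<phi>\<close> and \<open>g\<close> are parallel, all covariant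
  derivatives cancel, and each of the three objects becomes algebraic in the torsion:

  \<^item> \<open>d\<eta>\<^sub>i(X, Y) = T(X, Y, \<xi>\<^sub>i)\<close>, because \<open>\<eta>\<^sub>i\<close> is the metric dual of \<open>\<xi>\<^sub>i\<close>;
  \<^item> \<open>dF(X, Y, Z) = T(X, Y, \<phi>Z) + T(X, \<phi>Y, Z) + T(\<phi>X, Y, Z)\<close>;
  \<^item> \<open>N\<^sup>(\<^sup>1\<^sup>)(X, Y, Z) = T(X, Y, Z) - T(\<phi>X, \<phi>Y, Z) - T(X, \<phi>Y, \<phi>Z) - T(\<phi>X, Y, \<phi>Z)\<close>, where the summand
    \<open>\<Sum> d\<eta>\<^sub>i \<otimes> \<xi>\<^sub>i\<close> of \<open>N\<^sup>(\<^sup>1\<^sup>)\<close> cancels what \<open>\<phi>\<^sup>2\<close> adds to \<open>-Id\<close>.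

  Inserting \<open>\<phi>X\<close>, \<open>\<phi>Y\<close>, \<open>\<phi>Z\<close> into \<open>dF\<close> and reducing \<open>\<phi>\<^sup>2\<close> shows that in \<open>d\<^sup>\<phi>F + N\<^sup>(\<^sup>1\<^sup>)\<close> the terms
  \<open>T(\<phi>X, \<phi>Y, Z)\<close>, \<open>T(X, \<phi>Y, \<phi>Z)\<close>, \<open>T(\<phi>X, Y, \<phi>Z)\<close> cancel. What remains is \<open>T\<close> minus the
  vertical part \<open>\<Sum> \<eta>\<^sub>i \<and> \<beta>\<^sub>i\<close>, where \<open>\<beta>\<^sub>i(Y, Z) = T(\<phi>Y, \<phi>Z, \<xi>\<^sub>i)\<close>. As \<open>\<phi>\<xi>\<^sub>i = 0\<close>, the
  formula for \<open>N\<^sup>(\<^sup>1\<^sup>)\<close> gives \<open>\<xi>\<^sub>i \<lrcorner> N\<^sup>(\<^sup>1\<^sup>) = d\<eta>\<^sub>i - \<beta>\<^sub>i\<close>, so the two remaining sums of the theorem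
  restore exactly this vertical part.\<close>


section \<open>The algebra of smooth functions\<close>

text \<open>Openness of \<open>S\<close> is what lets the values on \<open>S\<close> determine the derivatives on \<open>S\<close>.\<close>

lemma frechet_derivative_cong_open:
  assumes "open S" "x \<in> S" "\<And>y. y \<in> S \<Longrightarrow> f y = h y" "f differentiable (at x)"
  shows "h differentiable (at x)" "frechet_derivative h (at x) = frechet_derivative f (at x)"
proof -
  have "(h has_derivative frechet_derivative f (at x)) (at x)"
    using assms has_derivative_transform_within_open frechet_derivative_works by metis
  then show "h differentiable (at x)" "frechet_derivative h (at x) = frechet_derivative f (at x)"
    by (auto simp: differentiable_def dest: frechet_derivative_at)
qed

lemma Ck_on_cong:
  assumes "open S" "\<And>x. x \<in> S \<Longrightarrow> f x = h x" "Ck_on k S f"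
  shows "Ck_on k S h"
  using assms(2,3)
proof (induction k arbitrary: f h)
  case 0
  then show ?case by (simp cong: continuous_on_cong)
next
  case (Suc k)
  have d: "f differentiable (at x)" if "x \<in> S" for x
    using Suc.prems(2) that by simp
  note c = frechet_derivative_cong_open[OF assms(1) _ Suc.prems(1) d]
  have "Ck_on k S (\<lambda>x. frechet_derivative h (at x) v)" for v
  proof (rule Suc.IH)
    show "Ck_on k S (\<lambda>x. frechet_derivative f (at x) v)"
      using Suc.prems(2) by simp
  qed (simp add: c(2))
  then show ?case using c(1) by simp
qed

lemma Ck_on_Suc_imp: "Ck_on (Suc k) S f \<Longrightarrow> Ck_on k S f"
proof (induction k arbitrary: f)
  case 0
  then show ?case
    by (auto intro!: differentiable_imp_continuous_on simp: differentiable_on_def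
        differentiable_at_withinI)
next
  case (Suc k)
  from Suc.prems have "\<forall>x\<in>S. f differentiable (at x)"
    and "\<And>v. Ck_on (Suc k) S (\<lambda>x. frechet_derivative f (at x) v)"
    by (auto simp del: Ck_on.simps(2) simp: Ck_on.simps(2)[of "Suc k"])
  with Suc.IH show ?case by simp
qed

lemma Ck_on_lincomb:
  fixes f h :: "'e::real_normed_vector \<Rightarrow> real"
  assumes "open S" "Ck_on k S f" "Ck_on k S h"
  shows "Ck_on k S (\<lambda>x. a * f x + b * h x)"
  using assms(2,3)
proof (induction k arbitrary: f h)
  case 0
  then show ?case by (auto intro!: continuous_intros)
next
  case (Suc k)
  have der: "((\<lambda>x. a * f x + b * h x) has_derivative
      (\<lambda>v. a * frechet_derivative f (at x) v + b * frechet_derivative h (at x) v)) (at x)"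
    if "x \<in> S" for x
  proof -
    have "(f has_derivative frechet_derivative f (at x)) (at x)"
      "(h has_derivative frechet_derivative h (at x)) (at x)"
      using Suc.prems that by (simp_all add: frechet_derivative_works[symmetric])
    then show ?thesis by (auto intro!: derivative_eq_intros)
  qed
  have "Ck_on k S (\<lambda>x. frechet_derivative (\<lambda>x. a * f x + b * h x) (at x) v)" for v
  proof (rule Ck_on_cong[OF assms(1)])
    show "Ck_on k S (\<lambda>x. a * frechet_derivative f (at x) v + b * frechet_derivative h (at x) v)"
      using Suc.prems by (intro Suc.IH) simp_all
  qed (simp add: frechet_derivative_at[OF der, symmetric])
  then show ?case using der by (auto simp: differentiable_def)
qed

lemma Ck_on_mult:
  fixes f h :: "'e::real_normed_vector \<Rightarrow> real"
  assumes "open S" "Ck_on k S f" "Ck_on k S h"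
  shows "Ck_on k S (\<lambda>x. f x * h x)"
  using assms(2,3)
proof (induction k arbitrary: f h)
  case 0
  then show ?case by (auto intro!: continuous_intros)
next
  case (Suc k)
  have der: "((\<lambda>x. f x * h x) has_derivative
      (\<lambda>v. f x * frechet_derivative h (at x) v + frechet_derivative f (at x) v * h x)) (at x)"
    if "x \<in> S" for x
  proof -
    have "(f has_derivative frechet_derivative f (at x)) (at x)"
      "(h has_derivative frechet_derivative h (at x)) (at x)"
      using Suc.prems that by (simp_all add: frechet_derivative_works[symmetric])
    then show ?thesis by (rule has_derivative_mult)
  qed
  have "Ck_on k S (\<lambda>x. frechet_derivative (\<lambda>x. f x * h x) (at x) v)" for v
  proof (rule Ck_on_cong[OF assms(1)])
    have "Ck_on k S (\<lambda>x. f x * frechet_derivative h (at x) v)"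
      "Ck_on k S (\<lambda>x. frechet_derivative f (at x) v * h x)"
      using Suc.prems Ck_on_Suc_imp[OF Suc.prems(1)] Ck_on_Suc_imp[OF Suc.prems(2)]
      by (auto intro!: Suc.IH)
    from Ck_on_lincomb[OF assms(1) this, of 1 1]
    show "Ck_on k S (\<lambda>x. f x * frechet_derivative h (at x) v + frechet_derivative f (at x) v * h x)"
      by simp
  qed (simp add: frechet_derivative_at[OF der, symmetric])
  then show ?case using der by (auto simp: differentiable_def)
qed

context smooth_manifold
begin

lemma smooth_funs_lincomb:
  assumes "f \<in> smooth_funs A" "h \<in> smooth_funs A"
  shows "(\<lambda>x. a * f x + b * h x) \<in> smooth_funs A"
  using assms charts_homeomorphism
  unfolding smooth_funs_def smooth_on_def comp_def by (fast intro: Ck_on_lincomb)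

lemma smooth_funs_mult:
  assumes "f \<in> smooth_funs A" "h \<in> smooth_funs A"
  shows "(\<lambda>x. f x * h x) \<in> smooth_funs A"
  using assms charts_homeomorphism
  unfolding smooth_funs_def smooth_on_def comp_def by (fast intro: Ck_on_mult)


section \<open>Tangent vectors and Lie brackets\<close>

lemma tangent_lincomb:
  "v \<in> tangent_space A p \<Longrightarrow> f \<in> smooth_funs A \<Longrightarrow> h \<in> smooth_funs A \<Longrightarrow>
    v (\<lambda>x. a * f x + b * h x) = a * v f + b * v h"
  by (simp add: tangent_space_def)

lemma tangent_Leibniz:
  "v \<in> tangent_space A p \<Longrightarrow> f \<in> smooth_funs A \<Longrightarrow> h \<in> smooth_funs A \<Longrightarrow>
    v (\<lambda>x. f x * h x) = f p * v h + h p * v f"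
  by (simp add: tangent_space_def)

lemma tangent_nonsmooth: "v \<in> tangent_space A p \<Longrightarrow> f \<notin> smooth_funs A \<Longrightarrow> v f = 0"
  by (simp add: tangent_space_def)

lemma tangent_const_zero: "v \<in> tangent_space A p \<Longrightarrow> v (\<lambda>x. 0) = 0"
  using tangent_lincomb[of v p "\<lambda>x. 0" "\<lambda>x. 0" 0 0] tangent_nonsmooth by fastforce

lemma tangent_space_subspace: "subspace (tangent_space A p)"
  unfolding subspace_def tangent_space_def
  by (auto simp: scaleR_fun_def algebra_simps)

lemma vfields_tangent: "X \<in> vfields A \<Longrightarrow> X p \<in> tangent_space A p"
  by (simp add: vfields_def)

lemma vfields_smooth: "X \<in> vfields A \<Longrightarrow> f \<in> smooth_funs A \<Longrightarrow> vderiv X f \<in> smooth_funs A"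
  by (simp add: vfields_def vderiv_def)

text \<open>In \<open>X(Y(fh))\<close> the products of first derivatives of \<open>f\<close> and \<open>h\<close> are symmetric in \<open>X\<close> and \<open>Y\<close>,
  so they drop out of the commutator, which is therefore again a derivation.\<close>

lemma lie_bracket_tangent:
  assumes X: "X \<in> vfields A" and Y: "Y \<in> vfields A"
  shows "lie_bracket X Y p \<in> tangent_space A p"
proof -
  have lin: "vderiv V (\<lambda>x. a * f x + b * h x) = (\<lambda>x. a * vderiv V f x + b * vderiv V h x)"
    if "V \<in> vfields A" "f \<in> smooth_funs A" "h \<in> smooth_funs A" for V f h a b
    using that by (auto simp: vderiv_def tangent_lincomb[OF vfields_tangent])
  have leib: "vderiv V (\<lambda>x. f x * h x) = (\<lambda>x. f x * vderiv V h x + h x * vderiv V f x)"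
    if "V \<in> vfields A" "f \<in> smooth_funs A" "h \<in> smooth_funs A" for V f h
    using that by (auto simp: vderiv_def tangent_Leibniz[OF vfields_tangent])
  have sec: "vderiv V (vderiv W (\<lambda>x. f x * h x)) x =
      f x * vderiv V (vderiv W h) x + vderiv W h x * vderiv V f x
      + (h x * vderiv V (vderiv W f) x + vderiv W f x * vderiv V h x)"
    if "V \<in> vfields A" "W \<in> vfields A" "f \<in> smooth_funs A" "h \<in> smooth_funs A" for V W f h x
    using lin[OF that(1) smooth_funs_mult smooth_funs_mult,
        of f "vderiv W h" h "vderiv W f" 1 1]
    by (simp add: that leib vfields_smooth)
  have zero: "vderiv V (vderiv W f) p = 0"
    if "V \<in> vfields A" "W \<in> vfields A" "f \<notin> smooth_funs A" for V W f
    using that tangent_const_zero[OF vfields_tangent]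
    by (simp add: vderiv_def tangent_nonsmooth[OF vfields_tangent])
  show ?thesis
    unfolding tangent_space_def lie_bracket_def mem_Collect_eq
  proof (intro conjI ballI allI impI)
    fix f h a b assume "f \<in> smooth_funs A" "h \<in> smooth_funs A"
    then show "vderiv X (vderiv Y (\<lambda>x. a * f x + b * h x)) p
        - vderiv Y (vderiv X (\<lambda>x. a * f x + b * h x)) p
      = a * (vderiv X (vderiv Y f) p - vderiv Y (vderiv X f) p)
        + b * (vderiv X (vderiv Y h) p - vderiv Y (vderiv X h) p)"
      by (simp add: lin X Y vfields_smooth algebra_simps)
  next
    fix f h assume "f \<in> smooth_funs A" "h \<in> smooth_funs A"
    then show "vderiv X (vderiv Y (\<lambda>x. f x * h x)) p - vderiv Y (vderiv X (\<lambda>x. f x * h x)) p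
      = f p * (vderiv X (vderiv Y h) p - vderiv Y (vderiv X h) p)
        + h p * (vderiv X (vderiv Y f) p - vderiv Y (vderiv X f) p)"
      by (simp add: sec X Y algebra_simps)
  next
    fix f assume "f \<notin> smooth_funs A"
    then show "vderiv X (vderiv Y f) p - vderiv Y (vderiv X f) p = 0"
      by (simp add: zero X Y)
  qed
qed

end


section \<open>Pointwise algebra of a metric \<open>f\<close>-structure\<close>

lemma sum_fun_apply: "(\<Sum>i\<in>I. f i) x = (\<Sum>i\<in>I. f i x)"
  by (induction I rule: infinite_finite_induct) auto

context metric_f_manifold
begin

lemmas tangent_diff = subspace_diff[OF tangent_space_subspace]
lemmas tangent_add = subspace_add[OF tangent_space_subspace]
lemmas tangent_neg = subspace_neg[OF tangent_space_subspace]
lemmas tangent_scale = subspace_scale[OF tangent_space_subspace]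
lemmas tangent_sum = subspace_sum[OF tangent_space_subspace]

lemma app_apply: "app \<phi> X p = \<phi> p (X p)"
  by (simp add: app_def)

lemma app_phi_vfield: "X \<in> vfields A \<Longrightarrow> app \<phi> X \<in> vfields A"
  using phi_tensor by (simp add: endo_field_def)

lemma phi_tangent: "u \<in> tangent_space A p \<Longrightarrow> \<phi> p u \<in> tangent_space A p"
  using phi_tensor by (simp add: endo_field_def)

lemma xi_tangent: "i \<in> {1..s} \<Longrightarrow> \<xi> i p \<in> tangent_space A p"
  using xi_vfield vfields_tangent by blast

lemma phi_diff:
  assumes "u \<in> tangent_space A p" "v \<in> tangent_space A p"
  shows "\<phi> p (u - v) = \<phi> p u - \<phi> p v"
proof -
  have "\<phi> p (1 *\<^sub>R u + (-1) *\<^sub>R v) = 1 *\<^sub>R \<phi> p u + (-1) *\<^sub>R \<phi> p v"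
    using phi_tensor assms unfolding endo_field_def by blast
  then show ?thesis by simp
qed

lemma phi_xi: "i \<in> {1..s} \<Longrightarrow> \<phi> p (\<xi> i p) = 0"
  using phi_kernel[of p] span_base[of "\<xi> i p" "(\<lambda>i. \<xi> i p) ` {1..s}"] by blast

lemma eta_diff:
  assumes "i \<in> {1..s}" "u \<in> tangent_space A p" "v \<in> tangent_space A p"
  shows "\<eta> i p (u - v) = \<eta> i p u - \<eta> i p v"
proof -
  have "\<eta> i p (1 *\<^sub>R u + (-1) *\<^sub>R v) = 1 * \<eta> i p u + (-1) * \<eta> i p v"
    using eta_form[OF assms(1)] assms(2,3) unfolding one_form_def by blast
  then show ?thesis by simp
qed

lemma g_commute:
  "u \<in> tangent_space A p \<Longrightarrow> v \<in> tangent_space A p \<Longrightarrow> g p u v = g p v u"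
  using metric unfolding riemannian_metric_def by blast

lemma g_lincomb_left:
  assumes "u \<in> tangent_space A p" "v \<in> tangent_space A p" "w \<in> tangent_space A p"
  shows "g p (a *\<^sub>R u + b *\<^sub>R v) w = a * g p u w + b * g p v w"
  using metric assms unfolding riemannian_metric_def by blast

lemma g_add_left:
  assumes "u \<in> tangent_space A p" "v \<in> tangent_space A p" "w \<in> tangent_space A p"
  shows "g p (u + v) w = g p u w + g p v w"
  using g_lincomb_left[OF assms, of 1 1] by simp

lemma g_diff_left:
  assumes "u \<in> tangent_space A p" "v \<in> tangent_space A p" "w \<in> tangent_space A p"
  shows "g p (u - v) w = g p u w - g p v w"
  using g_lincomb_left[OF assms, of 1 "-1"] by simp

lemma g_scale_left:
  assumes "u \<in> tangent_space A p" "w \<in> tangent_space A p"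
  shows "g p (a *\<^sub>R u) w = a * g p u w"
  using g_lincomb_left[OF assms(1,1,2), of a 0] by simp

lemma g_zero_left: "w \<in> tangent_space A p \<Longrightarrow> g p 0 w = 0"
  using g_scale_left[of w p w 0] by simp

lemma g_neg_left:
  assumes "u \<in> tangent_space A p" "w \<in> tangent_space A p"
  shows "g p (- u) w = - g p u w"
  using g_scale_left[OF assms, of "-1"] by simp

lemma g_sum_left:
  assumes "\<And>i. i \<in> I \<Longrightarrow> u i \<in> tangent_space A p" "w \<in> tangent_space A p"
  shows "g p (\<Sum>i\<in>I. u i) w = (\<Sum>i\<in>I. g p (u i) w)"
  using assms
  by (induction I rule: infinite_finite_induct)
    (simp_all add: g_zero_left g_add_left tangent_sum)

text \<open>Compatibility of \<open>g\<close> with \<open>\<phi>\<close>, applied to \<open>\<xi>\<^sub>i \<in> ker \<phi>\<close>, makes \<open>\<eta>\<^sub>i\<close> the metric dual of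
  \<open>\<xi>\<^sub>i\<close>.\<close>

lemma g_xi:
  assumes i: "i \<in> {1..s}" and u: "u \<in> tangent_space A p"
  shows "g p u (\<xi> i p) = \<eta> i p u"
proof -
  have "g p (\<phi> p u) (\<phi> p (\<xi> i p)) = 0"
    using g_commute[of 0 p "\<phi> p u"] g_zero_left[of "\<phi> p u" p] u
    by (simp add: phi_xi[OF i] phi_tangent subspace_0[OF tangent_space_subspace])
  moreover have "(\<Sum>j=1..s. \<eta> j p u * \<eta> j p (\<xi> i p)) = (\<Sum>j=1..s. if j = i then \<eta> j p u else 0)"
    by (rule sum.cong) (auto simp: eta_xi[OF _ i])
  ultimately show ?thesis
    using metric_compatible[OF u xi_tangent[OF i]] i by simp
qed

lemma g_phi_squared:
  assumes u: "u \<in> tangent_space A p" and w: "w \<in> tangent_space A p"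
  shows "g p (\<phi> p (\<phi> p u)) w = - g p u w + (\<Sum>i=1..s. \<eta> i p u * \<eta> i p w)"
proof -
  have "g p (\<Sum>i=1..s. \<eta> i p u *\<^sub>R \<xi> i p) w = (\<Sum>i=1..s. g p (\<eta> i p u *\<^sub>R \<xi> i p) w)"
    by (rule g_sum_left) (rule tangent_scale, rule xi_tangent, assumption, rule w)
  also have "\<dots> = (\<Sum>i=1..s. \<eta> i p u * \<eta> i p w)"
    by (rule sum.cong[OF refl])
      (simp add: g_scale_left xi_tangent w g_commute[of "\<xi> _ p" p w] g_xi)
  finally have sum: "g p (\<Sum>i=1..s. \<eta> i p u *\<^sub>R \<xi> i p) w = (\<Sum>i=1..s. \<eta> i p u * \<eta> i p w)" .
  have "(\<Sum>i=1..s. \<eta> i p u *\<^sub>R \<xi> i p) \<in> tangent_space A p"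
    by (rule tangent_sum) (rule tangent_scale, rule xi_tangent)
  with sum show ?thesis
    by (simp add: phi_squared[OF u] g_add_left g_neg_left tangent_neg u w
        del: add_uminus_conv_diff uminus_add_conv_diff)
qed

lemma g_phi_skew:
  assumes u: "u \<in> tangent_space A p" and v: "v \<in> tangent_space A p"
  shows "g p (\<phi> p u) v = - g p u (\<phi> p v)"
proof -
  have "g p (\<phi> p u) (\<phi> p (\<phi> p v)) = g p u (\<phi> p v)"
    using metric_compatible[OF u phi_tangent[OF v]] by (simp add: eta_phi v)
  moreover have "g p (\<phi> p u) (\<phi> p (\<phi> p v)) = - g p v (\<phi> p u)"
    using g_phi_squared[OF v phi_tangent[OF u]]
    by (simp add: g_commute phi_tangent u v eta_phi)
  ultimately show ?thesis
    by (simp add: g_commute phi_tangent u v)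
qed

end


section \<open>Structure tensors in terms of the torsion\<close>

locale parallel_skew_connection = metric_f_manifold A n s \<phi> \<xi> \<eta> g
  for A :: "('a::{t2_space, second_countable_topology}, 'e::real_normed_vector) chart set"
    and n s \<phi> \<xi> \<eta> g +
  fixes D :: "'a conn" and T :: "'a form3"
  assumes metric_conn: "metric_connection A g D"
    and skew_torsion: "has_skew_torsion A g D T"
    and phi_parallel: "\<And>X Y. X \<in> vfields A \<Longrightarrow> Y \<in> vfields A \<Longrightarrow> cov_endo D \<phi> X Y = 0"
    and eta_parallel: "\<And>i X Y. i \<in> {1..s} \<Longrightarrow> X \<in> vfields A \<Longrightarrow> Y \<in> vfields A \<Longrightarrow>
      cov_oneform D (\<eta> i) X Y = 0"
begin

lemma D_vfield: "X \<in> vfields A \<Longrightarrow> Y \<in> vfields A \<Longrightarrow> D X Y \<in> vfields A"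
  using metric_conn by (simp add: metric_connection_def connection_def)

lemma D_tangent: "X \<in> vfields A \<Longrightarrow> Y \<in> vfields A \<Longrightarrow> D X Y p \<in> tangent_space A p"
  by (simp add: D_vfield vfields_tangent)

lemma D_phi: "X \<in> vfields A \<Longrightarrow> Y \<in> vfields A \<Longrightarrow> D X (app \<phi> Y) = app \<phi> (D X Y)"
  using phi_parallel by (simp add: cov_endo_def)

lemma vderiv_eta:
  "i \<in> {1..s} \<Longrightarrow> X \<in> vfields A \<Longrightarrow> Y \<in> vfields A \<Longrightarrow> vderiv X (ev1 (\<eta> i) Y) = ev1 (\<eta> i) (D X Y)"
  using eta_parallel by (simp add: cov_oneform_def)

lemma vderiv_g:
  "X \<in> vfields A \<Longrightarrow> Y \<in> vfields A \<Longrightarrow> Z \<in> vfields A \<Longrightarrow>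
    vderiv X (ev2 g Y Z) = ev2 g (D X Y) Z + ev2 g Y (D X Z)"
  using metric_conn by (simp add: metric_connection_def cov_bilin_def algebra_simps)

lemma lie_bracket_torsion: "lie_bracket X Y p = D X Y p - D Y X p - torsion D X Y p"
  by (simp add: torsion_def)

lemma torsion_tangent:
  "X \<in> vfields A \<Longrightarrow> Y \<in> vfields A \<Longrightarrow> torsion D X Y p \<in> tangent_space A p"
  by (simp add: torsion_def tangent_diff D_tangent lie_bracket_tangent)

lemma T_torsion:
  "X \<in> vfields A \<Longrightarrow> Y \<in> vfields A \<Longrightarrow> Z \<in> vfields A \<Longrightarrow>
    T X Y Z p = g p (torsion D X Y p) (Z p)"
  using skew_torsion by (simp add: has_skew_torsion_def ev2_def)

lemma T_swap12:
  "X \<in> vfields A \<Longrightarrow> Y \<in> vfields A \<Longrightarrow> Z \<in> vfields A \<Longrightarrow> T X Y Z p = - T Y X Z p"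
  using skew_torsion unfolding has_skew_torsion_def three_form_def
  by (metis uminus_apply)

lemma T_swap23:
  "X \<in> vfields A \<Longrightarrow> Y \<in> vfields A \<Longrightarrow> Z \<in> vfields A \<Longrightarrow> T X Y Z p = - T X Z Y p"
  using skew_torsion unfolding has_skew_torsion_def three_form_def
  by (metis uminus_apply)

lemma ext_d_eta:
  assumes i: "i \<in> {1..s}" and X: "X \<in> vfields A" and Y: "Y \<in> vfields A"
  shows "ext_d1 (ev1 (\<eta> i)) X Y p = T X Y (\<xi> i) p"
  unfolding ext_d1_def vderiv_eta[OF i X Y] vderiv_eta[OF i Y X]
  by (simp add: ev1_def lie_bracket_torsion eta_diff[OF i] tangent_diff D_tangent torsion_tangent
      X Y T_torsion xi_vfield[OF i] g_xi[OF i])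

text \<open>Since \<open>F\<close> is parallel and skew, the covariant derivatives from \<open>X(F(Y, Z))\<close> and its permutations
  cancel those from the brackets. What the brackets leave are terms \<open>F(T(X, Y), Z) = T(X, Y, \<phi>Z)\<close>.\<close>

lemma ext_d_fundamental_form:
  assumes X: "X \<in> vfields A" and Y: "Y \<in> vfields A" and Z: "Z \<in> vfields A"
  shows "ext_d2 (fundamental_form \<phi> g) X Y Z p =
    T X Y (app \<phi> Z) p - T X Z (app \<phi> Y) p + T Y Z (app \<phi> X) p"
proof -
  have d: "vderiv V (fundamental_form \<phi> g U W) p =
      g p (D V U p) (\<phi> p (W p)) + g p (U p) (\<phi> p (D V W p))"
    if "V \<in> vfields A" "U \<in> vfields A" "W \<in> vfields A" for U V W
    unfolding fundamental_form_def using that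
    by (simp add: vderiv_g app_phi_vfield D_phi) (simp add: ev2_def app_apply)
  have b: "fundamental_form \<phi> g (lie_bracket U V) W p =
      g p (D U V p) (\<phi> p (W p)) - g p (D V U p) (\<phi> p (W p)) - T U V (app \<phi> W) p"
    if "V \<in> vfields A" "U \<in> vfields A" "W \<in> vfields A" for U V W
    using that
    by (simp add: fundamental_form_def ev2_def app_apply lie_bracket_torsion g_diff_left
        tangent_diff D_tangent torsion_tangent phi_tangent vfields_tangent
        T_torsion app_phi_vfield)
  have skew: "g p (U p) (\<phi> p (D V W p)) = - g p (D V W p) (\<phi> p (U p))"
    if "V \<in> vfields A" "U \<in> vfields A" "W \<in> vfields A" for U V W
    using that g_phi_skew[of "D V W p" p "U p"]
    by (simp add: g_commute phi_tangent D_tangent vfields_tangent)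
  show ?thesis
    unfolding ext_d2_def by (simp add: d b skew X Y Z)
qed

lemma T_phi_squared:
  assumes X: "X \<in> vfields A" and Y: "Y \<in> vfields A" and Z: "Z \<in> vfields A"
  shows "T X Y (app \<phi> (app \<phi> Z)) p = - T X Y Z p + (\<Sum>i=1..s. \<eta> i p (Z p) * T X Y (\<xi> i) p)"
proof -
  have "T X Y (app \<phi> (app \<phi> Z)) p = g p (\<phi> p (\<phi> p (Z p))) (torsion D X Y p)"
    using X Y Z
    by (simp add: T_torsion app_phi_vfield app_apply g_commute phi_tangent vfields_tangent
        torsion_tangent)
  also have "\<dots> = - T X Y Z p + (\<Sum>i=1..s. \<eta> i p (Z p) * \<eta> i p (torsion D X Y p))"
    using X Y Z g_phi_squared[of "Z p" p "torsion D X Y p"]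
    by (simp add: T_torsion vfields_tangent torsion_tangent g_commute)
  also have "(\<Sum>i=1..s. \<eta> i p (Z p) * \<eta> i p (torsion D X Y p)) =
      (\<Sum>i=1..s. \<eta> i p (Z p) * T X Y (\<xi> i) p)"
    by (rule sum.cong) (simp_all add: T_torsion X Y xi_vfield g_xi torsion_tangent)
  finally show ?thesis .
qed

text \<open>Every \<open>\<phi>\<^sup>2\<close> is moved into the last argument of \<open>T\<close> by skew-symmetry, where it can be reduced
  pointwise.\<close>

lemma d_phi_F_torsion:
  assumes X: "X \<in> vfields A" and Y: "Y \<in> vfields A" and Z: "Z \<in> vfields A"
  shows "d_phi_F \<phi> g X Y Z p =
    T (app \<phi> X) (app \<phi> Y) Z p + T (app \<phi> X) Y (app \<phi> Z) p + T X (app \<phi> Y) (app \<phi> Z) p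
    - (\<Sum>i=1..s. \<eta> i p (X p) * T (app \<phi> Y) (app \<phi> Z) (\<xi> i) p
        - \<eta> i p (Y p) * T (app \<phi> X) (app \<phi> Z) (\<xi> i) p
        + \<eta> i p (Z p) * T (app \<phi> X) (app \<phi> Y) (\<xi> i) p)"
proof -
  note v = X Y Z app_phi_vfield
  have "T (app \<phi> Y) (app \<phi> Z) X p = T X (app \<phi> Y) (app \<phi> Z) p"
    using T_swap23[of "app \<phi> Y" "app \<phi> Z" X p] T_swap12[of "app \<phi> Y" X "app \<phi> Z" p] v by simp
  moreover have "T (app \<phi> X) (app \<phi> Z) Y p = - T (app \<phi> X) Y (app \<phi> Z) p"
    using T_swap23[of "app \<phi> X" "app \<phi> Z" Y p] v by simp
  ultimately show ?thesis
    unfolding d_phi_F_def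
    by (simp add: v ext_d_fundamental_form T_phi_squared sum.distrib sum_subtractf)
qed

text \<open>In \<open>N\<^sub>\<phi>\<close> each covariant derivative occurs twice with opposite signs, because \<open>\<nabla>\<close> commutes with
  \<open>\<phi>\<close>.\<close>

lemma N_phi_torsion:
  assumes X: "X \<in> vfields A" and Y: "Y \<in> vfields A"
  shows "N_phi \<phi> X Y p =
    \<phi> p (torsion D X (app \<phi> Y) p) + \<phi> p (torsion D (app \<phi> X) Y p)
    - torsion D (app \<phi> X) (app \<phi> Y) p - \<phi> p (\<phi> p (torsion D X Y p))"
proof -
  note t = X Y app_phi_vfield tangent_diff D_tangent torsion_tangent phi_tangent
  have D: "D V (app \<phi> W) p = \<phi> p (D V W p)" if "V \<in> vfields A" "W \<in> vfields A" for V W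
    using that by (simp add: D_phi app_apply)
  show ?thesis
    by (simp add: N_phi_def app_apply lie_bracket_torsion phi_diff t D)
qed

lemma nijenhuis_form_torsion:
  assumes X: "X \<in> vfields A" and Y: "Y \<in> vfields A" and Z: "Z \<in> vfields A"
  shows "nijenhuis_form s \<phi> \<xi> \<eta> g X Y Z p =
    T X Y Z p - T (app \<phi> X) (app \<phi> Y) Z p - T X (app \<phi> Y) (app \<phi> Z) p
    - T (app \<phi> X) Y (app \<phi> Z) p"
proof -
  note t = X Y Z app_phi_vfield tangent_diff tangent_add torsion_tangent phi_tangent vfields_tangent
  let ?V = "\<Sum>i=1..s. T X Y (\<xi> i) p *\<^sub>R \<xi> i p"
  have N: "nijenhuis s \<phi> \<xi> \<eta> X Y p = N_phi \<phi> X Y p + ?V"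
    by (simp add: nijenhuis_def sum_fun_apply fscale_def ext_d_eta[OF _ X Y])
  have V: "?V \<in> tangent_space A p"
    by (rule tangent_sum) (rule tangent_scale, rule xi_tangent)
  have "g p ?V (Z p) = (\<Sum>i=1..s. g p (T X Y (\<xi> i) p *\<^sub>R \<xi> i p) (Z p))"
    by (rule g_sum_left) (rule tangent_scale, rule xi_tangent, assumption, rule vfields_tangent, rule Z)
  also have "\<dots> = (\<Sum>i=1..s. \<eta> i p (torsion D X Y p) * \<eta> i p (Z p))"
  proof (rule sum.cong[OF refl])
    fix i assume i: "i \<in> {1..s}"
    show "g p (T X Y (\<xi> i) p *\<^sub>R \<xi> i p) (Z p) = \<eta> i p (torsion D X Y p) * \<eta> i p (Z p)"
      using i g_commute[OF xi_tangent[OF i] vfields_tangent[OF Z], of p]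
      by (simp add: g_scale_left xi_tangent[OF i] t g_xi[OF i] T_torsion xi_vfield[OF i])
  qed
  finally have gV: "g p ?V (Z p) = (\<Sum>i=1..s. \<eta> i p (torsion D X Y p) * \<eta> i p (Z p))" .
  have T: "g p (torsion D U W p) (\<phi> p (Z p)) = T U W (app \<phi> Z) p"
    if "U \<in> vfields A" "W \<in> vfields A" for U W
    using that by (simp add: T_torsion t app_apply)
  show ?thesis
    unfolding nijenhuis_form_def ev2_def N
    by (simp add: N_phi_torsion[OF X Y] g_add_left g_diff_left t V gV g_phi_squared
        g_phi_skew[of "torsion D X (app \<phi> Y) p"] g_phi_skew[of "torsion D (app \<phi> X) Y p"] T
        T_torsion[of _ _ Z] del: One_nat_def)
qed

lemma interior_xi_nijenhuis_form:
  assumes i: "i \<in> {1..s}" and Y: "Y \<in> vfields A" and Z: "Z \<in> vfields A"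
  shows "interior3 (\<xi> i) (nijenhuis_form s \<phi> \<xi> \<eta> g) Y Z p =
    ext_d1 (ev1 (\<eta> i)) Y Z p - T (app \<phi> Y) (app \<phi> Z) (\<xi> i) p"
proof -
  have rot: "T V W (\<xi> i) p = T (\<xi> i) V W p" if "V \<in> vfields A" "W \<in> vfields A" for V W
    using that T_swap23[of V W "\<xi> i" p] T_swap12[of V "\<xi> i" W p] xi_vfield[OF i] by simp
  (* Skew-symmetry moves \<phi>\<xi>\<^sub>i = 0 into the last argument, where the metric evaluates it pointwise. *)
  have vanish: "T (app \<phi> (\<xi> i)) V W p = 0" if "V \<in> vfields A" "W \<in> vfields A" for V W
  proof -
    note v = that app_phi_vfield xi_vfield[OF i]
    have "T (app \<phi> (\<xi> i)) V W p = T V W (app \<phi> (\<xi> i)) p"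
      using T_swap23[of V W "app \<phi> (\<xi> i)" p] T_swap12[of V "app \<phi> (\<xi> i)" W p] v by simp
    also have "\<dots> = g p 0 (torsion D V W p)"
      using that by (simp add: T_torsion v app_apply phi_xi[OF i] g_commute torsion_tangent
          subspace_0[OF tangent_space_subspace])
    finally show ?thesis using that by (simp add: g_zero_left torsion_tangent)
  qed
  show ?thesis
    by (simp add: interior3_def nijenhuis_form_torsion ext_d_eta[OF i] Y Z xi_vfield[OF i] app_phi_vfield
        vanish rot)
qed

lemma torsion_formula:
  assumes X: "X \<in> vfields A" and Y: "Y \<in> vfields A" and Z: "Z \<in> vfields A"
  shows "T X Y Z =
    (\<Sum>i=1..s. wedge12 (ev1 (\<eta> i)) (ext_d1 (ev1 (\<eta> i))) X Y Z)
    + d_phi_F \<phi> g X Y Z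
    + nijenhuis_form s \<phi> \<xi> \<eta> g X Y Z
    - (\<Sum>i=1..s. wedge12 (ev1 (\<eta> i)) (interior3 (\<xi> i) (nijenhuis_form s \<phi> \<xi> \<eta> g)) X Y Z)"
proof
  fix p
  have "(\<Sum>i=1..s. wedge12 (ev1 (\<eta> i)) (ext_d1 (ev1 (\<eta> i))) X Y Z p)
      - (\<Sum>i=1..s. wedge12 (ev1 (\<eta> i)) (interior3 (\<xi> i) (nijenhuis_form s \<phi> \<xi> \<eta> g)) X Y Z p)
    = (\<Sum>i=1..s. \<eta> i p (X p) * T (app \<phi> Y) (app \<phi> Z) (\<xi> i) p
        - \<eta> i p (Y p) * T (app \<phi> X) (app \<phi> Z) (\<xi> i) p
        + \<eta> i p (Z p) * T (app \<phi> X) (app \<phi> Y) (\<xi> i) p)"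
    unfolding sum_subtractf[symmetric]
    by (rule sum.cong)
      (simp_all add: wedge12_def interior_xi_nijenhuis_form X Y Z ev1_def algebra_simps)
  then show "T X Y Z p =
    ((\<Sum>i=1..s. wedge12 (ev1 (\<eta> i)) (ext_d1 (ev1 (\<eta> i))) X Y Z)
    + d_phi_F \<phi> g X Y Z
    + nijenhuis_form s \<phi> \<xi> \<eta> g X Y Z
    - (\<Sum>i=1..s. wedge12 (ev1 (\<eta> i)) (interior3 (\<xi> i) (nijenhuis_form s \<phi> \<xi> \<eta> g)) X Y Z)) p"
    by (simp add: sum_fun_apply d_phi_F_torsion[OF X Y Z] nijenhuis_form_torsion[OF X Y Z])
qed

end

theorem theorem3p5:
  fixes A :: "('a::{t2_space, second_countable_topology}, 'e::real_normed_vector) chart set"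
    and n s :: nat
    and \<phi> :: "'a endo"
    and \<xi> :: "nat \<Rightarrow> 'a vfield"
    and \<eta> :: "nat \<Rightarrow> 'a oneform"
    and g :: "'a bilin"
    and Dg D :: "'a conn"
    and T :: "'a form3"
  assumes "metric_f_manifold A n s \<phi> \<xi> \<eta> g"
    and "\<forall>i\<in>{1..s}. \<forall>j\<in>{1..s}. lie_bracket (\<xi> i) (\<xi> j) = 0"
    and "levi_civita A g Dg"
    and "metric_connection A g D"
    and "has_skew_torsion A g D T"
    and "\<forall>X\<in>vfields A. \<forall>Y\<in>vfields A. \<forall>Z\<in>vfields A. \<forall>p.
           ev2 g (D X Y) Z p = ev2 g (Dg X Y) Z p + 1 / 2 * T X Y Z p"
    and "\<forall>X\<in>vfields A. \<forall>Y\<in>vfields A. cov_endo D \<phi> X Y = 0"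
    and "\<forall>i\<in>{1..s}. \<forall>X\<in>vfields A. D X (\<xi> i) = 0"
    and "\<forall>i\<in>{1..s}. \<forall>X\<in>vfields A. \<forall>Y\<in>vfields A. cov_oneform D (\<eta> i) X Y = 0"
  shows "\<forall>X\<in>vfields A. \<forall>Y\<in>vfields A. \<forall>Z\<in>vfields A.
           T X Y Z =
             (\<Sum>i=1..s. wedge12 (ev1 (\<eta> i)) (ext_d1 (ev1 (\<eta> i))) X Y Z)
             + d_phi_F \<phi> g X Y Z
             + nijenhuis_form s \<phi> \<xi> \<eta> g X Y Z
             - (\<Sum>i=1..s. wedge12 (ev1 (\<eta> i)) (interior3 (\<xi> i) (nijenhuis_form s \<phi> \<xi> \<eta> g)) X Y Z)"
proof -
  have "parallel_skew_connection A n s \<phi> \<xi> \<eta> g D T"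
    using assms by (simp add: parallel_skew_connection_def parallel_skew_connection_axioms_def)
  then show ?thesis
    by (intro ballI) (rule parallel_skew_connection.torsion_formula)
qed

end
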